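(* In four dimensions, the family $\{A^4_\varepsilon\}_{\varepsilon>0}$ of $4$-averages over the vertex set $J$ of the 24-cell (the cell of the 24-cell honeycomb, or icositetrachoric honeycomb), scaled by $\varepsilon$, has the asymptotic mean value property for the $4$-Laplacian. That is: there is a constant $c$ such that for every bounded domain $\Omega\subset\mathbb{R}^4$, with $\Omega_E=\{x\in\mathbb{R}^4:\operatorname{dist}(x,\Omega)<1\}$, and every $\phi\in C_b^\infty(\Omega_E)$ with $\nabla\phi\neq0$ everywhere on $\Omega_E$, $$\phi(x)=A^4_\varepsilon[\phi](x)+c\,\varepsilon^2\left(-\Delta_4^G\phi(x)\right)+o(\varepsilon^2)\quad\text{as }\varepsilon\to0^+,$$ uniformly for $x\in\Omega$.
   Context: $C_b^\infty(\Omega_E)$ denotes the smooth functions on $\Omega_E$ which are bounded together with all their derivatives. The vertex set $J\subset\mathbb{R}^4$ of the 24-cell centered at the origin consists of the 24 vectors obtained from $(1,1,0,0),(1,0,1,0),(1,0,0,1),(0,1,1,0),(0,1,0,1),(0,0,1,1)$ by replacing each entry $1$ by $\pm1$ in all possible ways. For $x\in\Omega$ and $\varepsilon>0$ small enough that $x+\varepsilon\eta\in\Omega_E$ for all $\eta\in J$, $A^4_\varepsilon[\phi](x)$ is the unique minimizer over $\lambda\in\mathbb{R}$ of $\sum_{\eta\in J}|\phi(x+\varepsilon\eta)-\lambda|^4$. The game (normalized) $p$-Laplacian of a smooth function $u$ at points where $\nabla u\ne0$ is $$\Delta_p^Gu=\frac1p|\nabla u|^{2-p}\operatorname{div}(|\nabla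 u|^{p-2}\nabla u)=\frac1p\Delta u+\frac{p-2}{p}|\nabla u|^{-2}\sum_{i,j}\frac{\partial u}{\partial x_i}\frac{\partial u}{\partial x_j}\frac{\partial^2u}{\partial x_i\partial x_j}.$$ *)

theory Defs
  imports "HOL-Analysis.Analysis"
begin

definition partial_deriv :: "'n::finite \<Rightarrow> (real^'n \<Rightarrow> real) \<Rightarrow> real^'n \<Rightarrow> real" where
  "partial_deriv i f x = frechet_derivative f (at x) (axis i 1)"

primrec iter_partial_deriv :: "'n::finite list \<Rightarrow> (real^'n \<Rightarrow> real) \<Rightarrow> real^'n \<Rightarrow> real" where
  "iter_partial_deriv [] f = f"
| "iter_partial_deriv (i # is) f = partial_deriv i (iter_partial_deriv is f)"

(* Intended for open U: smoothness is expressed by the (Frechet) differentiability on U of all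
   iterated partial derivatives. The values of f outside U are irrelevant. *)
definition Cb_infinity :: "(real^'n::finite) set \<Rightarrow> (real^'n \<Rightarrow> real) set" where
  "Cb_infinity U = {f. \<forall>is. (\<forall>x\<in>U. iter_partial_deriv is f differentiable (at x)) \<and>
                             bounded (iter_partial_deriv is f ` U)}"

definition grad :: "(real^'n::finite \<Rightarrow> real) \<Rightarrow> real^'n \<Rightarrow> real^'n" where
  "grad u x = (\<chi> i. partial_deriv i u x)"

definition divergence :: "(real^'n::finite \<Rightarrow> real^'n) \<Rightarrow> real^'n \<Rightarrow> real" where
  "divergence F x = (\<Sum>i\<in>UNIV. partial_deriv i (\<lambda>y. F y $ i) x)"

(* Meaningful only at points where the gradient of u does not vanish. *)
definition game_laplacian :: "real \<Rightarrow> (real^'n::finite \<Rightarrow> real) \<Rightarrow> real^'n \<Rightarrow> real" where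
  "game_laplacian p u x =
     1 / p * norm (grad u x) powr (2 - p) *
       divergence (\<lambda>y. norm (grad u y) powr (p - 2) *\<^sub>R grad u y) x"

definition p_average ::
    "real \<Rightarrow> (real^'n::finite) set \<Rightarrow> real \<Rightarrow> (real^'n \<Rightarrow> real) \<Rightarrow> real^'n \<Rightarrow> real" where
  "p_average p J \<epsilon> \<phi> x =
     (THE l. is_arg_min (\<lambda>m. \<Sum>\<eta>\<in>J. \<bar>\<phi> (x + \<epsilon> *\<^sub>R \<eta>) - m\<bar> powr p) (\<lambda>_. True) l)"

(* The minimizer in p_average exists and is unique for p = 4 and finite nonempty J. *)
lemma ex1_minimizer_4:
  assumes "finite J" "J \<noteq> {}"
  shows "\<exists>!l. is_arg_min (\<lambda>m. \<Sum>\<eta>\<in>J. \<bar>f \<eta> - m\<bar> powr 4) (\<lambda>_. True) (l::real)"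
proof -
  have pw: "\<bar>t\<bar> powr 4 = t^4" for t :: real
    by (cases "t = 0") (auto simp: powr_numeral)
  let ?S = "\<lambda>m. \<Sum>\<eta>\<in>J. (f \<eta> - m)^4"
  obtain e where e: "e \<in> J" using assms by auto
  define R where "R = ?S 0 + 1 + \<bar>f e\<bar>"
  have S0: "?S 0 \<ge> 0" by (intro sum_nonneg) auto
  have big: "?S m > ?S 0" if "\<bar>m\<bar> > R" for m
  proof -
    have a: "\<bar>f e - m\<bar> > ?S 0 + 1" using that by (auto simp: R_def)
    have "\<bar>f e - m\<bar> \<le> \<bar>f e - m\<bar>^4" using a S0 by (intro self_le_power) auto
    also have "\<dots> = (f e - m)^4" by simp
    also have "\<dots> \<le> ?S m" using e assms by (intro member_le_sum) auto
    finally show ?thesis using a by linarith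
  qed
  have "\<exists>l\<in>{-R..R}. \<forall>m\<in>{-R..R}. ?S l \<le> ?S m"
    using S0 by (intro continuous_attains_inf) (auto intro!: continuous_intros simp: R_def)
  then obtain l where l: "\<forall>m\<in>{-R..R}. ?S l \<le> ?S m" by blast
  have R0: "0 \<in> {-R..R}" using S0 by (auto simp: R_def)
  have glob: "?S l \<le> ?S m" for m
  proof (cases "\<bar>m\<bar> > R")
    case True then show ?thesis using bspec[OF l R0] big[of m] by linarith
  next
    case False then have "m \<in> {-R..R}" by auto
    then show ?thesis using l by blast
  qed
  have un: "a = b" if a: "\<And>m::real. ?S a \<le> ?S m" and b: "\<And>m::real. ?S b \<le> ?S m" for a b
  proof (rule ccontr)
    assume ne: "a \<noteq> b"
    have "2 * ((u+v)/2)^4 < u^4 + v^4" if "u \<noteq> v" for u v :: real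
    proof -
      have "u^4+v^4 - 2*((u+v)/2)^4 = (u-v)^2 * (7*u^2+10 * u * v+7 * v^2)/8"
        by (simp add: field_simps power2_eq_square eval_nat_numeral)
      moreover have "7*u^2+10 * u * v+7 * v^2 = 5*(u+v)^2 + 2*u^2+2 * v^2"
        by (simp add: power2_eq_square algebra_simps)
      moreover have "5*(u+v)^2 + 2*u^2+2 * v^2 > 0" using that
        by (smt (verit) zero_less_power2 zero_le_power2)
      ultimately show ?thesis using that by (smt (verit) mult_pos_pos zero_less_divide_iff zero_less_power2)
    qed
    note st = this
    have "2 * (f x - (a+b)/2)^4 < (f x - a)^4 + (f x - b)^4" for x
    proof -
      have e: "((f x - a) + (f x - b)) / 2 = f x - (a+b)/2" by (simp add: field_simps)
      have "f x - a \<noteq> f x - b" using ne by simp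
      from st[OF this] show ?thesis by (simp only: e)
    qed
    then have "(\<Sum>x\<in>J. 2 * (f x - (a+b)/2)^4) < (\<Sum>x\<in>J. (f x - a)^4 + (f x - b)^4)"
      using assms by (intro sum_strict_mono) auto
    then have "2 * ?S ((a+b)/2) < ?S a + ?S b" by (simp add: sum.distrib sum_distrib_left)
    then show False using a[of "(a+b)/2"] b[of "(a+b)/2"] by linarith
  qed
  show ?thesis unfolding pw is_arg_min_def
    using glob un by (intro ex1I[of _ l]) (auto simp: not_less)
qed

definition cell24_vertices :: "(real^4) set" where
  "cell24_vertices = {\<eta>. \<exists>w \<in> {vector [1,1,0,0], vector [1,0,1,0], vector [1,0,0,1],
                                vector [0,1,1,0], vector [0,1,0,1], vector [0,0,1,1]}.
                          \<forall>i. \<eta> $ i = w $ i \<or> \<eta> $ i = - w $ i}"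

definition extended_domain :: "'a::metric_space set \<Rightarrow> 'a set" where
  "extended_domain \<Omega> = {x. infdist x \<Omega> < 1}"

end

theory Submission
  imports Defs
begin

text \<open>
  Write \<open>g\<close> for the gradient and \<open>H\<close> for the Hessian of \<open>\<phi>\<close> at \<open>x\<close>. Setting the derivative of the
  sum of fourth powers to zero shows that the average \<open>l\<close> solves
  \<open>\<Sum>\<eta>. (\<phi>(x + \<epsilon>\<eta>) - l)^3 = 0\<close>. Put \<open>l = \<phi>(x) + \<epsilon>^2 m\<close> and insert the Taylor expansion
  \<open>\<phi>(x + \<epsilon>\<eta>) = \<phi>(x) + \<epsilon> (g \<bullet> \<eta>) + \<epsilon>^2 q(\<eta>) + O(\<epsilon>^3)\<close> with \<open>q(\<eta>) = (\<eta> \<bullet> H \<eta>) / 2\<close>. The term of order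
  \<open>\<epsilon>^3\<close> is \<open>\<Sum>\<eta>. (g \<bullet> \<eta>)^3\<close>, which vanishes because the vertex set is symmetric about the origin; the
  term of order \<open>\<epsilon>^4\<close> is \<open>3 \<Sum>\<eta>. (g \<bullet> \<eta>)^2 (q(\<eta>) - m)\<close>. Hence \<open>m\<close> is, up to \<open>O(\<epsilon>)\<close>, the mean \<open>\<mu>\<close> of
  \<open>q\<close> over the vertices with weights \<open>(g \<bullet> \<eta>)^2\<close>.

  The 24-cell enters through its moments: up to degree four they are those of a
  rotation-invariant measure (its vertices form a spherical 5-design). Therefore
  \<open>\<Sum>\<eta>. (g \<bullet> \<eta>)^2 = 12 |g|^2\<close> and
  \<open>\<Sum>\<eta>. (g \<bullet> \<eta>)^2 (\<eta> \<bullet> H \<eta>) = 4 (|g|^2 tr H + 2 g \<bullet> H g)\<close>, so that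
  \<open>\<mu> = (tr H + 2 (g \<bullet> H g) / |g|^2) / 6\<close>. This is two thirds of the game 4-Laplacian, whence
  \<open>c = 2/3\<close>.

  The expansion is made quantitative without differentiating the minimizer. The function
  \<open>m \<mapsto> \<Sum>\<eta>. (\<phi>(x + \<epsilon>\<eta>) - m)^3\<close> changes sign at the minimizer (\<open>p_average_4_bracket\<close>), so it is enough to
  determine its sign at \<open>\<phi>(x) + \<epsilon>^2 (\<mu> \<plusminus> \<delta>)\<close>, where the leading term \<open>\<mp>3 \<delta> \<epsilon>^4 \<Sum>\<eta>. (g \<bullet> \<eta>)^2\<close> dominates
  for small \<open>\<epsilon>\<close> (\<open>p_average_4_expansion\<close>). How small \<open>\<epsilon>\<close> has to be depends only on \<open>\<delta>\<close>, on a common bound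
  of the derivatives of order at most three, and on a positive lower bound of \<open>|g|\<close>. The last
  exists on \<open>\<Omega>\<close> because the closure of \<open>\<Omega>\<close> is a compact subset of the extended domain
  (\<open>grad_bounded_below\<close>), and this gives uniformity.
\<close>

section \<open>Locating the minimizer of a quartic sum\<close>

lemma quartic_above_tangent:
  fixes u w :: real
  shows "w ^ 4 + 4 * w ^ 3 * (u - w) \<le> u ^ 4"
proof -
  have "u ^ 4 - w ^ 4 - 4 * w ^ 3 * (u - w) = (u - w)\<^sup>2 * ((u + w)\<^sup>2 + 2 * w\<^sup>2)"
    by (simp add: power2_eq_square eval_nat_numeral algebra_simps)
  also have "\<dots> \<ge> 0" by simp
  finally show ?thesis by simp
qed

lemma p_average_4_minimal:
  assumes "finite J" "J \<noteq> {}"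
  shows "(\<Sum>\<eta>\<in>J. (\<phi> (x + \<epsilon> *\<^sub>R \<eta>) - p_average 4 J \<epsilon> \<phi> x) ^ 4)
           \<le> (\<Sum>\<eta>\<in>J. (\<phi> (x + \<epsilon> *\<^sub>R \<eta>) - m) ^ 4)"
proof -
  have pw: "\<bar>t\<bar> powr 4 = t ^ 4" for t :: real
    by (cases "t = 0") (auto simp: powr_numeral)
  have "is_arg_min (\<lambda>m. \<Sum>\<eta>\<in>J. \<bar>\<phi> (x + \<epsilon> *\<^sub>R \<eta>) - m\<bar> powr 4) (\<lambda>_. True) (p_average 4 J \<epsilon> \<phi> x)"
    unfolding p_average_def by (rule theI', rule ex1_minimizer_4[OF assms])
  then show ?thesis
    unfolding is_arg_min_def pw by (auto simp: not_less)
qed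

text \<open>Convexity in \<open>m\<close>: the left-hand side is the tangent line at \<open>a\<close>.\<close>

lemma quartic_sum_above_tangent:
  fixes v :: "'a \<Rightarrow> real"
  shows "(\<Sum>\<eta>\<in>J. (v \<eta> - a) ^ 4) + 4 * (a - m) * (\<Sum>\<eta>\<in>J. (v \<eta> - a) ^ 3)
           \<le> (\<Sum>\<eta>\<in>J. (v \<eta> - m) ^ 4)"
proof -
  have "(v \<eta> - a) ^ 4 + 4 * (a - m) * (v \<eta> - a) ^ 3 \<le> (v \<eta> - m) ^ 4" for \<eta>
    using quartic_above_tangent[of "v \<eta> - a" "v \<eta> - m"] by (simp add: algebra_simps)
  then show ?thesis
    unfolding sum_distrib_left sum.distrib[symmetric] by (intro sum_mono) auto
qed

text \<open>A convex function can be minimal only where its tangents at \<open>a\<close> and \<open>b\<close> allow: a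
  negative slope at \<open>a\<close> pushes the minimizer to the right of \<open>a\<close>, a positive slope at \<open>b\<close> to the left
  of \<open>b\<close>. The sums of cubes are these slopes up to the factor \<open>-4\<close>.\<close>

lemma p_average_4_bracket:
  assumes "finite J" "J \<noteq> {}"
    and lo: "(\<Sum>\<eta>\<in>J. (\<phi> (x + \<epsilon> *\<^sub>R \<eta>) - a) ^ 3) > 0"
    and hi: "(\<Sum>\<eta>\<in>J. (\<phi> (x + \<epsilon> *\<^sub>R \<eta>) - b) ^ 3) < 0"
  shows "a \<le> p_average 4 J \<epsilon> \<phi> x" "p_average 4 J \<epsilon> \<phi> x \<le> b"
proof -
  let ?l = "p_average 4 J \<epsilon> \<phi> x"
  have "(c - ?l) * (\<Sum>\<eta>\<in>J. (\<phi> (x + \<epsilon> *\<^sub>R \<eta>) - c) ^ 3) \<le> 0" for c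
    using p_average_4_minimal[OF assms(1,2), where \<phi> = \<phi> and x = x and \<epsilon> = \<epsilon> and m = c]
      quartic_sum_above_tangent[where J = J and v = "\<lambda>\<eta>. \<phi> (x + \<epsilon> *\<^sub>R \<eta>)" and a = c and m = ?l]
    by linarith
  from this[of a] this[of b] lo hi show "a \<le> ?l" "?l \<le> b"
    by (auto simp: mult_le_0_iff)
qed

text \<open>Expanding the cube, the first term sums to zero and the next one is
  \<open>3 \<epsilon> \<alpha>^2 \<beta>\<close>. The function \<open>b\<close> is a model of \<open>\<beta>\<close> that is correct up to \<open>O(\<epsilon>)\<close>; replacing \<open>\<beta>\<close> by \<open>b\<close>
  costs \<open>3 A^2 R \<epsilon>^2\<close>, and the two remaining terms of the expansion supply the rest of the constant.\<close>

lemma cubic_sum_estimate: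
  fixes \<alpha> \<beta> b :: "'a \<Rightarrow> real"
  assumes odd: "(\<Sum>\<eta>\<in>J. \<alpha> \<eta> ^ 3) = 0"
    and A: "\<And>\<eta>. \<eta> \<in> J \<Longrightarrow> \<bar>\<alpha> \<eta>\<bar> \<le> A"
    and B: "\<And>\<eta>. \<eta> \<in> J \<Longrightarrow> \<bar>\<beta> \<eta>\<bar> \<le> B"
    and R: "\<And>\<eta>. \<eta> \<in> J \<Longrightarrow> \<bar>\<beta> \<eta> - b \<eta>\<bar> \<le> R * \<epsilon>"
    and \<epsilon>: "0 \<le> \<epsilon>" "\<epsilon> \<le> 1"
  shows "\<bar>(\<Sum>\<eta>\<in>J. (\<alpha> \<eta> + \<epsilon> * \<beta> \<eta>) ^ 3) - 3 * \<epsilon> * (\<Sum>\<eta>\<in>J. (\<alpha> \<eta>)\<^sup>2 * b \<eta>)\<bar>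
           \<le> of_nat (card J) * (3 * A\<^sup>2 * R + 3 * A * B\<^sup>2 + B ^ 3) * \<epsilon>\<^sup>2"
proof -
  let ?K = "3 * A\<^sup>2 * R + 3 * A * B\<^sup>2 + B ^ 3"
  have "(\<Sum>\<eta>\<in>J. (\<alpha> \<eta> + \<epsilon> * \<beta> \<eta>) ^ 3) - 3 * \<epsilon> * (\<Sum>\<eta>\<in>J. (\<alpha> \<eta>)\<^sup>2 * b \<eta>)
      = (\<Sum>\<eta>\<in>J. (\<alpha> \<eta> + \<epsilon> * \<beta> \<eta>) ^ 3 - \<alpha> \<eta> ^ 3 - 3 * \<epsilon> * ((\<alpha> \<eta>)\<^sup>2 * b \<eta>))"
    by (simp add: sum_subtractf odd sum_distrib_left)
  also have "\<bar>\<dots>\<bar> \<le> (\<Sum>\<eta>\<in>J. \<bar>(\<alpha> \<eta> + \<epsilon> * \<beta> \<eta>) ^ 3 - \<alpha> \<eta> ^ 3 - 3 * \<epsilon> * ((\<alpha> \<eta>)\<^sup>2 * b \<eta>)\<bar>)"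
    by (rule sum_abs)
  also have "\<dots> \<le> (\<Sum>\<eta>\<in>J. ?K * \<epsilon>\<^sup>2)"
  proof (rule sum_mono)
    fix \<eta> assume \<eta>: "\<eta> \<in> J"
    have A0: "0 \<le> A" and B0: "0 \<le> B" using A[OF \<eta>] B[OF \<eta>] by auto
    have eq: "(\<alpha> \<eta> + \<epsilon> * \<beta> \<eta>) ^ 3 - \<alpha> \<eta> ^ 3 - 3 * \<epsilon> * ((\<alpha> \<eta>)\<^sup>2 * b \<eta>)
      = 3 * \<epsilon> * ((\<alpha> \<eta>)\<^sup>2 * (\<beta> \<eta> - b \<eta>)) + 3 * \<epsilon>\<^sup>2 * (\<alpha> \<eta> * (\<beta> \<eta>)\<^sup>2) + \<epsilon>\<^sup>2 * (\<epsilon> * \<beta> \<eta> ^ 3)"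
      by (simp add: power2_eq_square power3_eq_cube algebra_simps)
    have "\<bar>(\<alpha> \<eta>)\<^sup>2 * (\<beta> \<eta> - b \<eta>)\<bar> \<le> A\<^sup>2 * (R * \<epsilon>)"
      unfolding abs_mult power_abs using A[OF \<eta>] R[OF \<eta>] by (intro mult_mono power_mono) auto
    then have 1: "\<bar>3 * \<epsilon> * ((\<alpha> \<eta>)\<^sup>2 * (\<beta> \<eta> - b \<eta>))\<bar> \<le> 3 * \<epsilon> * (A\<^sup>2 * (R * \<epsilon>))"
      unfolding abs_mult[of "3 * \<epsilon>"] using \<epsilon> by (intro mult_mono) auto
    have "\<bar>\<alpha> \<eta> * (\<beta> \<eta>)\<^sup>2\<bar> \<le> A * B\<^sup>2"
      unfolding abs_mult power_abs using A[OF \<eta>] B[OF \<eta>] A0 by (intro mult_mono power_mono) auto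
    then have 2: "\<bar>3 * \<epsilon>\<^sup>2 * (\<alpha> \<eta> * (\<beta> \<eta>)\<^sup>2)\<bar> \<le> 3 * \<epsilon>\<^sup>2 * (A * B\<^sup>2)"
      unfolding abs_mult[of "3 * \<epsilon>\<^sup>2"] using \<epsilon> by (intro mult_mono) auto
    have "\<bar>\<epsilon> * \<beta> \<eta> ^ 3\<bar> \<le> 1 * B ^ 3"
      unfolding abs_mult power_abs using B[OF \<eta>] \<epsilon> by (intro mult_mono power_mono) auto
    then have 3: "\<bar>\<epsilon>\<^sup>2 * (\<epsilon> * \<beta> \<eta> ^ 3)\<bar> \<le> \<epsilon>\<^sup>2 * B ^ 3"
      unfolding abs_mult[of "\<epsilon>\<^sup>2"] by (intro mult_mono) auto
    have "?K * \<epsilon>\<^sup>2 = 3 * \<epsilon> * (A\<^sup>2 * (R * \<epsilon>)) + 3 * \<epsilon>\<^sup>2 * (A * B\<^sup>2) + \<epsilon>\<^sup>2 * B ^ 3"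
      by (simp add: power2_eq_square algebra_simps)
    then show "\<bar>(\<alpha> \<eta> + \<epsilon> * \<beta> \<eta>) ^ 3 - \<alpha> \<eta> ^ 3 - 3 * \<epsilon> * ((\<alpha> \<eta>)\<^sup>2 * b \<eta>)\<bar> \<le> ?K * \<epsilon>\<^sup>2"
      unfolding eq using 1 2 3 by linarith
  qed
  also have "\<dots> = of_nat (card J) * ?K * \<epsilon>\<^sup>2" by simp
  finally show ?thesis .
qed

text \<open>The asymptotic expansion for an arbitrary finite set of directions with vanishing cubic
  moment: \<open>\<epsilon> \<alpha>\<close> and \<open>\<epsilon>^2 q\<close> are the first and second order parts of the increment of \<open>\<phi>\<close>, and \<open>\<mu>\<close> is
  the mean of \<open>q\<close> with weights \<open>\<alpha>^2\<close>. All constants are explicit, since they have to be chosen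
  independently of \<open>x\<close>. The number \<open>2 * Q + 1 + R\<close> bounds \<open>\<beta> - \<mu> - t\<close> for \<open>\<bar>t\<bar> \<le> 1\<close>, where \<open>\<epsilon>^2 \<beta>\<close> is
  the increment without its linear part.\<close>

lemma p_average_4_expansion:
  fixes \<alpha> q :: "real^'n::finite \<Rightarrow> real"
  assumes J: "finite J" "J \<noteq> {}"
    and odd: "(\<Sum>\<eta>\<in>J. \<alpha> \<eta> ^ 3) = 0"
    and bal: "(\<Sum>\<eta>\<in>J. (\<alpha> \<eta>)\<^sup>2 * q \<eta>) = \<mu> * (\<Sum>\<eta>\<in>J. (\<alpha> \<eta>)\<^sup>2)"
    and A: "\<And>\<eta>. \<eta> \<in> J \<Longrightarrow> \<bar>\<alpha> \<eta>\<bar> \<le> A"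
    and Q: "\<And>\<eta>. \<eta> \<in> J \<Longrightarrow> \<bar>q \<eta>\<bar> \<le> Q"
    and taylor: "\<And>\<eta>. \<eta> \<in> J \<Longrightarrow>
          \<bar>\<phi> (x + \<epsilon> *\<^sub>R \<eta>) - (\<phi> x + \<epsilon> * \<alpha> \<eta> + \<epsilon>\<^sup>2 * q \<eta>)\<bar> \<le> R * \<epsilon> ^ 3"
    and \<epsilon>: "0 < \<epsilon>" "\<epsilon> \<le> 1" and \<delta>: "0 < \<delta>" "\<delta> \<le> 1"
    and small: "of_nat (card J) * (3 * A\<^sup>2 * R + 3 * A * (2 * Q + 1 + R)\<^sup>2 + (2 * Q + 1 + R) ^ 3) * \<epsilon>
                  < 3 * \<delta> * (\<Sum>\<eta>\<in>J. (\<alpha> \<eta>)\<^sup>2)"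
  shows "\<bar>p_average 4 J \<epsilon> \<phi> x - (\<phi> x + \<epsilon>\<^sup>2 * \<mu>)\<bar> \<le> \<delta> * \<epsilon>\<^sup>2"
proof -
  let ?S = "\<Sum>\<eta>\<in>J. (\<alpha> \<eta>)\<^sup>2"
  let ?B = "2 * Q + 1 + R"
  let ?K = "of_nat (card J) * (3 * A\<^sup>2 * R + 3 * A * ?B\<^sup>2 + ?B ^ 3)"
  define \<beta> where "\<beta> \<eta> = (\<phi> (x + \<epsilon> *\<^sub>R \<eta>) - \<phi> x - \<epsilon> * \<alpha> \<eta>) / \<epsilon>\<^sup>2" for \<eta>
  have val: "\<phi> (x + \<epsilon> *\<^sub>R \<eta>) = \<phi> x + \<epsilon> * (\<alpha> \<eta> + \<epsilon> * \<beta> \<eta>)" for \<eta>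
    using \<epsilon> by (simp add: \<beta>_def field_simps power2_eq_square)
  have rem: "\<bar>\<beta> \<eta> - q \<eta>\<bar> \<le> R * \<epsilon>" if "\<eta> \<in> J" for \<eta>
  proof -
    have "\<epsilon>\<^sup>2 * \<bar>\<beta> \<eta> - q \<eta>\<bar> = \<bar>\<epsilon>\<^sup>2 * (\<beta> \<eta> - q \<eta>)\<bar>" by (simp add: abs_mult)
    also have "\<dots> = \<bar>\<phi> (x + \<epsilon> *\<^sub>R \<eta>) - (\<phi> x + \<epsilon> * \<alpha> \<eta> + \<epsilon>\<^sup>2 * q \<eta>)\<bar>"
      unfolding val by (simp add: power2_eq_square algebra_simps)
    also have "\<dots> \<le> \<epsilon>\<^sup>2 * (R * \<epsilon>)"
      using taylor[OF that] by (simp add: power2_eq_square power3_eq_cube mult_ac)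
    finally show ?thesis using \<epsilon> by simp
  qed
  obtain e where e: "e \<in> J" using J by auto
  have R0: "0 \<le> R" using rem[OF e] \<epsilon> by (smt (verit) mult_neg_pos)
  have A0: "0 \<le> A" and Q0: "0 \<le> Q" using A[OF e] Q[OF e] by auto
  have S0: "0 < ?S"
  proof -
    have "0 \<le> ?K * \<epsilon>" using A0 Q0 R0 \<epsilon> by simp
    then have "0 < 3 * \<delta> * ?S" using small by linarith
    then show ?thesis using \<delta> by (simp add: zero_less_mult_iff)
  qed
  \<comment> \<open>A weighted mean of \<open>q\<close> obeys the same bound as \<open>q\<close>.\<close>
  have mu: "\<bar>\<mu>\<bar> \<le> Q"
  proof -
    have "\<bar>\<mu>\<bar> * ?S = \<bar>\<Sum>\<eta>\<in>J. (\<alpha> \<eta>)\<^sup>2 * q \<eta>\<bar>" using S0 by (simp add: bal abs_mult)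
    also have "\<dots> \<le> (\<Sum>\<eta>\<in>J. (\<alpha> \<eta>)\<^sup>2 * Q)"
      using Q by (intro order_trans[OF sum_abs] sum_mono) (auto simp: abs_mult intro!: mult_left_mono)
    also have "\<dots> = Q * ?S" by (simp add: sum_distrib_left mult.commute)
    finally show ?thesis using S0 by simp
  qed
  \<comment> \<open>As \<open>\<mu>\<close> is the weighted mean of \<open>q\<close>, only the shift \<open>t\<close> contributes at order \<open>\<epsilon>^4\<close>.\<close>
  have est: "\<bar>(\<Sum>\<eta>\<in>J. (\<phi> (x + \<epsilon> *\<^sub>R \<eta>) - (\<phi> x + \<epsilon>\<^sup>2 * (\<mu> + t))) ^ 3) + \<epsilon> ^ 4 * (3 * t * ?S)\<bar>
      \<le> \<epsilon> ^ 4 * (?K * \<epsilon>)" if t: "\<bar>t\<bar> \<le> 1" for t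
  proof -
    let ?\<beta> = "\<lambda>\<eta>. \<beta> \<eta> - \<mu> - t"
    let ?b = "\<lambda>\<eta>. q \<eta> - \<mu> - t"
    have bd: "\<bar>?\<beta> \<eta>\<bar> \<le> ?B" if "\<eta> \<in> J" for \<eta>
    proof -
      have "R * \<epsilon> \<le> R" using R0 \<epsilon> by (simp add: mult_left_le)
      then show ?thesis using rem[OF that] Q[OF that] mu t by linarith
    qed
    have b: "(\<Sum>\<eta>\<in>J. (\<alpha> \<eta>)\<^sup>2 * ?b \<eta>) = - t * ?S"
    proof -
      have "(\<alpha> \<eta>)\<^sup>2 * ?b \<eta> = (\<alpha> \<eta>)\<^sup>2 * q \<eta> - (\<mu> + t) * (\<alpha> \<eta>)\<^sup>2" for \<eta>
        by (simp add: algebra_simps)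
      then have "(\<Sum>\<eta>\<in>J. (\<alpha> \<eta>)\<^sup>2 * ?b \<eta>) = (\<Sum>\<eta>\<in>J. (\<alpha> \<eta>)\<^sup>2 * q \<eta>) - (\<mu> + t) * ?S"
        by (simp only: sum_subtractf sum_distrib_left)
      then show ?thesis unfolding bal by (simp add: distrib_right)
    qed
    have "\<bar>(\<Sum>\<eta>\<in>J. (\<alpha> \<eta> + \<epsilon> * ?\<beta> \<eta>) ^ 3) - 3 * \<epsilon> * (\<Sum>\<eta>\<in>J. (\<alpha> \<eta>)\<^sup>2 * ?b \<eta>)\<bar> \<le> ?K * \<epsilon>\<^sup>2"
      using A bd rem \<epsilon> by (intro cubic_sum_estimate odd) auto
    then have 1: "\<epsilon> ^ 3 * \<bar>(\<Sum>\<eta>\<in>J. (\<alpha> \<eta> + \<epsilon> * ?\<beta> \<eta>) ^ 3) + 3 * \<epsilon> * t * ?S\<bar> \<le> \<epsilon> ^ 3 * (?K * \<epsilon>\<^sup>2)"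
      unfolding b using \<epsilon> by (intro mult_left_mono) auto
    have "\<phi> (x + \<epsilon> *\<^sub>R \<eta>) - (\<phi> x + \<epsilon>\<^sup>2 * (\<mu> + t)) = \<epsilon> * (\<alpha> \<eta> + \<epsilon> * ?\<beta> \<eta>)" for \<eta>
      unfolding val by (simp add: power2_eq_square algebra_simps)
    then have "(\<Sum>\<eta>\<in>J. (\<phi> (x + \<epsilon> *\<^sub>R \<eta>) - (\<phi> x + \<epsilon>\<^sup>2 * (\<mu> + t))) ^ 3)
        = \<epsilon> ^ 3 * (\<Sum>\<eta>\<in>J. (\<alpha> \<eta> + \<epsilon> * ?\<beta> \<eta>) ^ 3)"
      by (simp only: power_mult_distrib sum_distrib_left)
    then have "\<bar>(\<Sum>\<eta>\<in>J. (\<phi> (x + \<epsilon> *\<^sub>R \<eta>) - (\<phi> x + \<epsilon>\<^sup>2 * (\<mu> + t))) ^ 3) + \<epsilon> ^ 4 * (3 * t * ?S)\<bar>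
        = \<bar>\<epsilon> ^ 3 * ((\<Sum>\<eta>\<in>J. (\<alpha> \<eta> + \<epsilon> * ?\<beta> \<eta>) ^ 3) + 3 * \<epsilon> * t * ?S)\<bar>"
      by (simp only: distrib_left) (simp add: eval_nat_numeral mult_ac)
    also have "\<dots> = \<epsilon> ^ 3 * \<bar>(\<Sum>\<eta>\<in>J. (\<alpha> \<eta> + \<epsilon> * ?\<beta> \<eta>) ^ 3) + 3 * \<epsilon> * t * ?S\<bar>"
      using \<epsilon> by (simp add: abs_mult)
    also note 1
    also have "\<epsilon> ^ 3 * (?K * \<epsilon>\<^sup>2) = \<epsilon> ^ 4 * (?K * \<epsilon>)"
      by (simp add: eval_nat_numeral mult_ac)
    finally show ?thesis .
  qed
  have gap: "\<epsilon> ^ 4 * (?K * \<epsilon>) < \<epsilon> ^ 4 * (3 * \<delta> * ?S)" using small \<epsilon> by simp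
  have "(\<Sum>\<eta>\<in>J. (\<phi> (x + \<epsilon> *\<^sub>R \<eta>) - (\<phi> x + \<epsilon>\<^sup>2 * (\<mu> + - \<delta>))) ^ 3) > 0"
    using est[of "- \<delta>"] gap \<delta> by simp
  moreover have "(\<Sum>\<eta>\<in>J. (\<phi> (x + \<epsilon> *\<^sub>R \<eta>) - (\<phi> x + \<epsilon>\<^sup>2 * (\<mu> + \<delta>))) ^ 3) < 0"
    using est[of \<delta>] gap \<delta> by simp
  ultimately have "\<phi> x + \<epsilon>\<^sup>2 * (\<mu> + - \<delta>) \<le> p_average 4 J \<epsilon> \<phi> x"
      "p_average 4 J \<epsilon> \<phi> x \<le> \<phi> x + \<epsilon>\<^sup>2 * (\<mu> + \<delta>)"
    using p_average_4_bracket[OF J] by blast+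
  then show ?thesis by (simp add: algebra_simps abs_le_iff)
qed

section \<open>Second order Taylor expansion\<close>

lemma frechet_derivative_eq_sum_partial:
  fixes h :: "real^'n::finite \<Rightarrow> real"
  assumes "h differentiable (at y)"
  shows "frechet_derivative h (at y) v = (\<Sum>i\<in>UNIV. v $ i * partial_deriv i h y)"
proof -
  have lin: "linear (frechet_derivative h (at y))"
    using assms by (rule linear_frechet_derivative)
  have "frechet_derivative h (at y) (\<Sum>i\<in>UNIV. v $ i *\<^sub>R axis i 1)
      = (\<Sum>i\<in>UNIV. v $ i * partial_deriv i h y)"
    by (simp add: linear_sum[OF lin] linear_scale[OF lin] partial_deriv_def)
  moreover have "(\<Sum>i\<in>UNIV. v $ i *\<^sub>R axis i 1) = v"
    using basis_expansion[of v] by (simp add: scalar_mult_eq_scaleR)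
  ultimately show ?thesis by simp
qed

lemma has_real_derivative_along_line:
  fixes h :: "real^'n::finite \<Rightarrow> real"
  assumes "h differentiable (at (x + t *\<^sub>R v))"
  shows "((\<lambda>t. h (x + t *\<^sub>R v)) has_real_derivative
           (\<Sum>i\<in>UNIV. v $ i * partial_deriv i h (x + t *\<^sub>R v))) (at t)"
proof -
  let ?y = "x + t *\<^sub>R v"
  let ?D = "frechet_derivative h (at ?y)"
  have "((\<lambda>t. x + t *\<^sub>R v) has_derivative (\<lambda>s. s *\<^sub>R v)) (at t)"
    by (auto intro!: derivative_eq_intros)
  from has_derivative_compose[OF this, of h ?D] assms
  have "((\<lambda>t. h (x + t *\<^sub>R v)) has_derivative (\<lambda>s. ?D (s *\<^sub>R v))) (at t)"
    by (simp add: frechet_derivative_works)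
  moreover have "?D (s *\<^sub>R v) = (\<Sum>i\<in>UNIV. v $ i * partial_deriv i h ?y) * s" for s
    by (simp add: frechet_derivative_eq_sum_partial[OF assms] sum_distrib_left mult_ac)
  ultimately show ?thesis
    by (simp add: has_field_derivative_def)
qed

text \<open>The one-dimensional expansion along the segment from \<open>x\<close> to \<open>x + \<epsilon> v\<close>. Only points of that
  segment are involved, so that differentiability of \<open>f\<close> on the extended domain will suffice.\<close>

lemma taylor_2_bound:
  fixes f :: "real^'n::finite \<Rightarrow> real"
  assumes "0 < \<epsilon>"
    and diff: "\<And>t is. 0 \<le> t \<Longrightarrow> t \<le> \<epsilon> \<Longrightarrow> iter_partial_deriv is f differentiable (at (x + t *\<^sub>R v))"
    and M: "\<And>t i j k. 0 \<le> t \<Longrightarrow> t \<le> \<epsilon> \<Longrightarrow> \<bar>iter_partial_deriv [i, j, k] f (x + t *\<^sub>R v)\<bar> \<le> M"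
    and v: "\<And>i. \<bar>v $ i\<bar> \<le> 1"
  shows "\<bar>f (x + \<epsilon> *\<^sub>R v) - (f x + \<epsilon> * (grad f x \<bullet> v)
            + \<epsilon>\<^sup>2 * ((\<Sum>i\<in>UNIV. \<Sum>j\<in>UNIV. v $ i * v $ j * iter_partial_deriv [i, j] f x) / 2))\<bar>
          \<le> real (CARD('n) ^ 3) * M * \<epsilon> ^ 3"
proof -
  let ?y = "\<lambda>t. x + t *\<^sub>R v"
  let ?f1 = "\<lambda>t. \<Sum>k\<in>UNIV. v $ k * iter_partial_deriv [k] f (?y t)"
  let ?f2 = "\<lambda>t. \<Sum>j\<in>UNIV. \<Sum>k\<in>UNIV. v $ j * v $ k * iter_partial_deriv [j, k] f (?y t)"
  let ?f3 = "\<lambda>t. \<Sum>i\<in>UNIV. \<Sum>j\<in>UNIV. \<Sum>k\<in>UNIV. v $ i * v $ j * v $ k * iter_partial_deriv [i, j, k] f (?y t)"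
  \<comment> \<open>\<open>d m\<close> is the derivative of order \<open>m\<close> along the line, for \<open>m \<le> 3\<close>.\<close>
  define d where "d m = (case m of 0 \<Rightarrow> (\<lambda>t. f (?y t)) | Suc 0 \<Rightarrow> ?f1 | Suc (Suc 0) \<Rightarrow> ?f2 | _ \<Rightarrow> ?f3)"
    for m :: nat
  have d: "((\<lambda>t. iter_partial_deriv is f (?y t)) has_real_derivative
             (\<Sum>i\<in>UNIV. v $ i * iter_partial_deriv (i # is) f (?y t))) (at t)"
    if "0 \<le> t" "t \<le> \<epsilon>" for t "is"
    using has_real_derivative_along_line[OF diff[OF that]] by simp
  have d0: "((\<lambda>t. f (?y t)) has_real_derivative ?f1 t) (at t)" if "0 \<le> t" "t \<le> \<epsilon>" for t
    using d[OF that, of "[]"] by simp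
  have d1: "(?f1 has_real_derivative ?f2 t) (at t)" if "0 \<le> t" "t \<le> \<epsilon>" for t
  proof -
    have "(?f1 has_real_derivative
       (\<Sum>k\<in>UNIV. v $ k * (\<Sum>j\<in>UNIV. v $ j * iter_partial_deriv [j, k] f (?y t)))) (at t)"
      by (intro DERIV_sum DERIV_cmult d that)
    also have "(\<Sum>k\<in>UNIV. v $ k * (\<Sum>j\<in>UNIV. v $ j * iter_partial_deriv [j, k] f (?y t))) = ?f2 t"
      unfolding sum_distrib_left by (subst sum.swap) (simp add: mult_ac)
    finally show ?thesis .
  qed
  have d2: "(?f2 has_real_derivative ?f3 t) (at t)" if "0 \<le> t" "t \<le> \<epsilon>" for t
  proof -
    have "(?f2 has_real_derivative
       (\<Sum>j\<in>UNIV. \<Sum>k\<in>UNIV. v $ j * v $ k * (\<Sum>i\<in>UNIV. v $ i * iter_partial_deriv [i, j, k] f (?y t)))) (at t)"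
      by (intro DERIV_sum DERIV_cmult d that)
    also have "(\<Sum>j\<in>UNIV. \<Sum>k\<in>UNIV. v $ j * v $ k * (\<Sum>i\<in>UNIV. v $ i * iter_partial_deriv [i, j, k] f (?y t)))
       = (\<Sum>j\<in>UNIV. \<Sum>i\<in>UNIV. \<Sum>k\<in>UNIV. v $ i * v $ j * v $ k * iter_partial_deriv [i, j, k] f (?y t))"
      unfolding sum_distrib_left by (subst sum.swap) (simp add: mult_ac)
    also have "\<dots> = ?f3 t" by (rule sum.swap)
    finally show ?thesis .
  qed
  have "\<forall>m t. m < 3 \<and> 0 \<le> t \<and> t \<le> \<epsilon> \<longrightarrow> (d m has_real_derivative d (Suc m) t) (at t)"
    using d0 d1 d2 by (auto simp: d_def eval_nat_numeral less_Suc_eq)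
  from Maclaurin[OF \<open>0 < \<epsilon>\<close> _ _ this, of "\<lambda>t. f (?y t)"]
  obtain t where t: "0 < t" "t < \<epsilon>"
    and eq: "f (?y \<epsilon>) = (\<Sum>m<3. d m 0 / fact m * \<epsilon> ^ m) + d 3 t / fact 3 * \<epsilon> ^ 3"
    by (auto simp: d_def)
  have lin: "?f1 0 = grad f x \<bullet> v"
    by (simp add: inner_vec_def grad_def mult.commute)
  have "\<bar>?f3 t\<bar> \<le> (\<Sum>i\<in>(UNIV::'n set). \<Sum>j\<in>(UNIV::'n set). \<Sum>k\<in>(UNIV::'n set). M)"
  proof (intro order_trans[OF sum_abs] sum_mono)
    fix i j k
    have "\<bar>v $ i * v $ j * v $ k * iter_partial_deriv [i, j, k] f (?y t)\<bar> \<le> 1 * 1 * 1 * M"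
      unfolding abs_mult using v M[of t i j k] t by (intro mult_mono) auto
    then show "\<bar>v $ i * v $ j * v $ k * iter_partial_deriv [i, j, k] f (?y t)\<bar> \<le> M" by simp
  qed
  also have "\<dots> = real (CARD('n) ^ 3) * M" by (simp add: power3_eq_cube)
  finally have f3: "\<bar>?f3 t\<bar> \<le> real (CARD('n) ^ 3) * M" .
  have "f (?y \<epsilon>) - (f x + \<epsilon> * (grad f x \<bullet> v)
            + \<epsilon>\<^sup>2 * ((\<Sum>i\<in>UNIV. \<Sum>j\<in>UNIV. v $ i * v $ j * iter_partial_deriv [i, j] f x) / 2))
      = ?f3 t / 6 * \<epsilon> ^ 3"
    unfolding eq lin[symmetric] by (simp add: d_def eval_nat_numeral)
  also have "\<bar>\<dots>\<bar> = \<bar>?f3 t\<bar> / 6 * \<epsilon> ^ 3"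
    using \<open>0 < \<epsilon>\<close> by (simp add: abs_mult)
  also have "\<dots> \<le> real (CARD('n) ^ 3) * M * \<epsilon> ^ 3"
    using f3 \<open>0 < \<epsilon>\<close> by (intro mult_right_mono) auto
  finally show ?thesis .
qed

section \<open>The game 4-Laplacian\<close>

text \<open>Since \<open>|g|^(4 - 2)\<close> is the polynomial \<open>|g|^2\<close> in the first derivatives, the product rule gives
  \<open>div (|g|^2 g) = |g|^2 tr H + 2 g \<bullet> H g\<close>.\<close>

lemma game_laplacian_4_eq:
  fixes u :: "real^'n::finite \<Rightarrow> real"
  assumes diff: "\<And>i. partial_deriv i u differentiable (at x)"
    and nz: "grad u x \<noteq> 0"
  shows "game_laplacian 4 u x =
    ((\<Sum>i\<in>UNIV. iter_partial_deriv [i, i] u x)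
      + 2 * (\<Sum>i\<in>UNIV. \<Sum>j\<in>UNIV. grad u x $ i * grad u x $ j * iter_partial_deriv [i, j] u x)
          / (norm (grad u x))\<^sup>2) / 4"
proof -
  let ?g = "grad u x"
  let ?H = "\<lambda>i j. iter_partial_deriv [i, j] u x"
  have sq: "norm (grad u y) powr 2 = (\<Sum>k\<in>UNIV. (partial_deriv k u y)\<^sup>2)" for y
  proof -
    have "norm (grad u y) powr 2 = (norm (grad u y))\<^sup>2" by (simp add: powr_numeral)
    also have "\<dots> = grad u y \<bullet> grad u y" by (rule power2_norm_eq_inner)
    finally show ?thesis
      by (simp add: inner_vec_def grad_def power2_eq_square)
  qed
  have D: "(partial_deriv j u has_derivative frechet_derivative (partial_deriv j u) (at x)) (at x)" for j
    using diff frechet_derivative_works by blast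
  have pd: "partial_deriv i (\<lambda>y. (norm (grad u y) powr 2 *\<^sub>R grad u y) $ i) x
      = (norm ?g)\<^sup>2 * ?H i i + 2 * (\<Sum>j\<in>UNIV. ?g $ i * ?g $ j * ?H i j)" for i
  proof -
    let ?F = "\<lambda>y. (\<Sum>k\<in>UNIV. (partial_deriv k u y)\<^sup>2) * partial_deriv i u y"
    have F: "(\<lambda>y. (norm (grad u y) powr 2 *\<^sub>R grad u y) $ i) = ?F"
      by (simp only: sq) (simp add: grad_def)
    have "(?F has_derivative (\<lambda>h. (\<Sum>k\<in>UNIV. (partial_deriv k u x)\<^sup>2) * frechet_derivative (partial_deriv i u) (at x) h
         + (\<Sum>k\<in>UNIV. 2 * (partial_deriv k u x * frechet_derivative (partial_deriv k u) (at x) h)) * partial_deriv i u x)) (at x)"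
      by (auto intro!: derivative_eq_intros D simp: power2_eq_square)
    then have "partial_deriv i ?F x = (\<Sum>k\<in>UNIV. (partial_deriv k u x)\<^sup>2) * ?H i i
         + (\<Sum>k\<in>UNIV. 2 * (partial_deriv k u x * ?H i k)) * partial_deriv i u x"
      unfolding partial_deriv_def[of i ?F] by (simp add: frechet_derivative_at[symmetric] partial_deriv_def)
    moreover have "(\<Sum>k\<in>UNIV. (partial_deriv k u x)\<^sup>2) = (norm ?g)\<^sup>2"
      using sq[of x] by (simp add: powr_numeral)
    moreover have "(\<Sum>k\<in>UNIV. 2 * (partial_deriv k u x * ?H i k)) * partial_deriv i u x
        = 2 * (\<Sum>j\<in>UNIV. ?g $ i * ?g $ j * ?H i j)"
      by (simp add: grad_def sum_distrib_left sum_distrib_right mult_ac)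
    ultimately show ?thesis unfolding F by simp
  qed
  have div: "divergence (\<lambda>y. norm (grad u y) powr 2 *\<^sub>R grad u y) x
      = (norm ?g)\<^sup>2 * (\<Sum>i\<in>UNIV. ?H i i) + 2 * (\<Sum>i\<in>UNIV. \<Sum>j\<in>UNIV. ?g $ i * ?g $ j * ?H i j)"
    unfolding divergence_def pd by (simp add: sum.distrib sum_distrib_left)
  have powr: "norm ?g powr - 2 = 1 / (norm ?g)\<^sup>2"
    using nz by (simp add: powr_minus powr_numeral divide_inverse)
  have cancel: "1 / 4 * (1 / n) * (n * T + 2 * q) = (T + 2 * q / n) / 4" if "n \<noteq> 0" for n T q :: real
    using that by (simp add: field_simps)
  show ?thesis
    using cancel[of "(norm ?g)\<^sup>2"] nz div powr by (simp add: game_laplacian_def)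
qed

section \<open>Moments of the 24-cell\<close>

lemma vector_4 [simp]:
  "(vector [a, b, c, d] :: ('a::zero)^4) $ 1 = a"
  "(vector [a, b, c, d] :: ('a::zero)^4) $ 2 = b"
  "(vector [a, b, c, d] :: ('a::zero)^4) $ 3 = c"
  "(vector [a, b, c, d] :: ('a::zero)^4) $ 4 = d"
  unfolding vector_def by simp_all

lemma vector_4_eq_iff:
  "(vector [a, b, c, d] :: real^4) = vector [a', b', c', d'] \<longleftrightarrow> a = a' \<and> b = b' \<and> c = c' \<and> d = d'"
  by (auto simp: vec_eq_iff forall_4 vector_4)

lemma vector_4_sign_changes:
  "{\<eta> :: real^4. \<forall>i. \<eta> $ i = vector [a, b, c, d] $ i \<or> \<eta> $ i = - vector [a, b, c, d] $ i}
     = (\<Union>x\<in>{a, -a}. \<Union>y\<in>{b, -b}. \<Union>z\<in>{c, -c}. \<Union>u\<in>{d, -d}. {vector [x, y, z, u]})"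
  by (simp only: set_eq_iff mem_Collect_eq UN_iff singleton_iff vec_eq_iff forall_4 vector_4) blast

lemma cell24_vertices_eq:
  "cell24_vertices =
    {vector [1,1,0,0], vector [1,-1,0,0], vector [-1,1,0,0], vector [-1,-1,0,0],
     vector [1,0,1,0], vector [1,0,-1,0], vector [-1,0,1,0], vector [-1,0,-1,0],
     vector [1,0,0,1], vector [1,0,0,-1], vector [-1,0,0,1], vector [-1,0,0,-1],
     vector [0,1,1,0], vector [0,1,-1,0], vector [0,-1,1,0], vector [0,-1,-1,0],
     vector [0,1,0,1], vector [0,1,0,-1], vector [0,-1,0,1], vector [0,-1,0,-1],
     vector [0,0,1,1], vector [0,0,1,-1], vector [0,0,-1,1], vector [0,0,-1,-1]}"
  (is "_ = ?V")
proof -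
  have "cell24_vertices = (\<Union>w\<in>{vector [1,1,0,0], vector [1,0,1,0], vector [1,0,0,1],
                                vector [0,1,1,0], vector [0,1,0,1], vector [0,0,1,1]}.
                          {\<eta>. \<forall>i. \<eta> $ i = w $ i \<or> \<eta> $ i = - w $ i})"
    unfolding cell24_vertices_def by (rule Collect_bex_eq)
  also have "\<dots> = ?V"
    by (simp only: UN_insert UN_empty vector_4_sign_changes minus_zero insert_absorb2
        Un_insert_left Un_empty_left Un_empty_right)
  finally show ?thesis .
qed

lemma finite_cell24_vertices: "finite cell24_vertices"
  by (simp add: cell24_vertices_eq)

lemma cell24_vertices_coord_le_1:
  assumes "\<eta> \<in> cell24_vertices" shows "\<bar>\<eta> $ i\<bar> \<le> 1"
proof -
  have "\<forall>\<eta>\<in>cell24_vertices. \<forall>i. \<bar>\<eta> $ i\<bar> \<le> 1"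
    unfolding cell24_vertices_eq by (simp add: forall_4)
  with assms show ?thesis by blast
qed

text \<open>The vertex set is invariant under \<open>\<eta> \<mapsto> - \<eta>\<close>, which changes the sign of the summand.\<close>

lemma sum_cell24_odd_moment:
  "(\<Sum>\<eta>\<in>cell24_vertices. (g \<bullet> \<eta>) ^ 3) = 0"
proof -
  have neg: "- \<eta> \<in> cell24_vertices" if "\<eta> \<in> cell24_vertices" for \<eta>
  proof -
    have "(\<forall>i. \<eta> $ i = w $ i \<or> \<eta> $ i = - w $ i)
        \<longrightarrow> (\<forall>i. (- \<eta>) $ i = w $ i \<or> (- \<eta>) $ i = - w $ i)" for w :: "real^4"
      by auto
    then show ?thesis
      using that unfolding cell24_vertices_def by (elim CollectE bexE) (intro CollectI bexI; blast)
  qed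
  have "(\<Sum>\<eta>\<in>cell24_vertices. (g \<bullet> \<eta>) ^ 3) = (\<Sum>\<eta>\<in>cell24_vertices. (g \<bullet> (- \<eta>)) ^ 3)"
    using neg by (intro sum.reindex_bij_witness[of _ uminus uminus]) auto
  also have "\<dots> = - (\<Sum>\<eta>\<in>cell24_vertices. (g \<bullet> \<eta>) ^ 3)"
    by (simp add: sum_negf)
  finally show ?thesis by simp
qed

lemma sum_cell24_vertices:
  fixes f :: "real^4 \<Rightarrow> real"
  shows "sum f cell24_vertices =
     f (vector [1,1,0,0]) + f (vector [1,-1,0,0]) + f (vector [-1,1,0,0]) + f (vector [-1,-1,0,0]) +
     f (vector [1,0,1,0]) + f (vector [1,0,-1,0]) + f (vector [-1,0,1,0]) + f (vector [-1,0,-1,0]) +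
     f (vector [1,0,0,1]) + f (vector [1,0,0,-1]) + f (vector [-1,0,0,1]) + f (vector [-1,0,0,-1]) +
     f (vector [0,1,1,0]) + f (vector [0,1,-1,0]) + f (vector [0,-1,1,0]) + f (vector [0,-1,-1,0]) +
     f (vector [0,1,0,1]) + f (vector [0,1,0,-1]) + f (vector [0,-1,0,1]) + f (vector [0,-1,0,-1]) +
     f (vector [0,0,1,1]) + f (vector [0,0,1,-1]) + f (vector [0,0,-1,1]) + f (vector [0,0,-1,-1])"
  unfolding cell24_vertices_eq by (simp add: vector_4_eq_iff)

lemma sum_cell24_second_moment:
  "(\<Sum>\<eta>\<in>cell24_vertices. (g \<bullet> \<eta>)\<^sup>2) = 12 * (norm g)\<^sup>2"
  unfolding sum_cell24_vertices power2_norm_eq_inner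
  by (simp add: inner_vec_def sum_4 vector_4) (simp add: power2_eq_square algebra_simps)

text \<open>This is where the 24-cell is special: the coordinates satisfy
  \<open>\<Sum>\<eta>. \<eta>_i^4 = 12\<close> and \<open>\<Sum>\<eta>. \<eta>_i^2 \<eta>_j^2 = 4\<close> for \<open>i \<noteq> j\<close>, and the ratio 3 is exactly what makes the quartic
  moment tensor isotropic. For another ratio a term \<open>\<Sum>i. g_i^2 H_i_i\<close> would
  survive on the right-hand side.\<close>

lemma sum_cell24_fourth_moment:
  "(\<Sum>\<eta>\<in>cell24_vertices. (g \<bullet> \<eta>)\<^sup>2 * (\<Sum>i\<in>UNIV. \<Sum>j\<in>UNIV. \<eta> $ i * \<eta> $ j * H i j))
     = 4 * ((norm g)\<^sup>2 * (\<Sum>i\<in>UNIV. H i i) + 2 * (\<Sum>i\<in>UNIV. \<Sum>j\<in>UNIV. g $ i * g $ j * H i j))"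
  unfolding sum_cell24_vertices power2_norm_eq_inner
  by (simp add: inner_vec_def sum_4 vector_4) (simp add: power2_eq_square algebra_simps)

text \<open>Identifies the weighted mean of the second order part of \<open>u\<close> as two thirds of the game
  4-Laplacian.\<close>

lemma cell24_balance:
  assumes diff: "\<And>i. partial_deriv i u differentiable (at x)" and nz: "grad u x \<noteq> 0"
  shows "(\<Sum>\<eta>\<in>cell24_vertices. (grad u x \<bullet> \<eta>)\<^sup>2
            * ((\<Sum>i\<in>UNIV. \<Sum>j\<in>UNIV. \<eta> $ i * \<eta> $ j * iter_partial_deriv [i, j] u x) / 2))
         = 2 / 3 * game_laplacian 4 u x * (\<Sum>\<eta>\<in>cell24_vertices. (grad u x \<bullet> \<eta>)\<^sup>2)"
proof -
  have "(norm (grad u x))\<^sup>2 \<noteq> 0" using nz by simp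
  then show ?thesis
    unfolding times_divide_eq_right sum_divide_distrib[symmetric] sum_cell24_fourth_moment
      sum_cell24_second_moment game_laplacian_4_eq[OF assms]
    by (simp add: field_simps)
qed

section \<open>Bounds that are uniform on the domain\<close>

text \<open>There are only finitely many partial derivatives of order at most \<open>k\<close>.\<close>

lemma Cb_infinity_uniform_bound:
  fixes f :: "real^'n::finite \<Rightarrow> real"
  assumes "f \<in> Cb_infinity U"
  obtains M where "0 \<le> M" "\<And>is x. length is \<le> k \<Longrightarrow> x \<in> U \<Longrightarrow> \<bar>iter_partial_deriv is f x\<bar> \<le> M"
proof -
  let ?L = "{is :: 'n list. set is \<subseteq> UNIV \<and> length is \<le> k}"
  have "finite ?L" by (rule finite_lists_length_le) simp
  moreover have "bounded (iter_partial_deriv is f ` U)" for "is"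
    using assms by (simp add: Cb_infinity_def)
  ultimately have "bounded (\<Union>is\<in>?L. iter_partial_deriv is f ` U)"
    by (intro bounded_UN) auto
  then obtain M where M: "\<forall>y\<in>(\<Union>is\<in>?L. iter_partial_deriv is f ` U). norm y \<le> M"
    unfolding bounded_iff by blast
  have "\<bar>iter_partial_deriv is f x\<bar> \<le> max 0 M" if "length is \<le> k" "x \<in> U" for "is" x
    using M that by fastforce
  then show ?thesis using that[of "max 0 M"] by auto
qed

text \<open>The gradient may tend to zero at the boundary of the extended domain, but the closure of \<open>\<Omega>\<close>
  lies inside the extended domain and is compact.\<close>

lemma grad_bounded_below:
  fixes \<phi> :: "real^'n::finite \<Rightarrow> real"
  assumes "bounded \<Omega>" "\<Omega> \<noteq> {}" and \<phi>: "\<phi> \<in> Cb_infinity (extended_domain \<Omega>)"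
    and nz: "\<And>x. x \<in> extended_domain \<Omega> \<Longrightarrow> grad \<phi> x \<noteq> 0"
  obtains \<gamma> where "0 < \<gamma>" "\<And>x. x \<in> \<Omega> \<Longrightarrow> \<gamma> \<le> norm (grad \<phi> x)"
proof -
  have sub: "closure \<Omega> \<subseteq> extended_domain \<Omega>"
    using in_closure_iff_infdist_zero[OF assms(2)] by (auto simp: extended_domain_def)
  have "continuous_on (closure \<Omega>) (\<lambda>x. partial_deriv i \<phi> x)" for i
  proof (rule continuous_at_imp_continuous_on, rule ballI)
    fix x assume "x \<in> closure \<Omega>"
    then have "iter_partial_deriv [i] \<phi> differentiable (at x)"
      using sub \<phi> unfolding Cb_infinity_def by blast
    then show "isCont (\<lambda>x. partial_deriv i \<phi> x) x"
      by (simp add: differentiable_imp_continuous_within)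
  qed
  then have "continuous_on (closure \<Omega>) (\<lambda>x. norm (grad \<phi> x))"
    unfolding grad_def by (intro continuous_intros)
  moreover have "compact (closure \<Omega>)" "closure \<Omega> \<noteq> {}" using assms by auto
  ultimately obtain z where z: "z \<in> closure \<Omega>" "\<forall>x\<in>closure \<Omega>. norm (grad \<phi> z) \<le> norm (grad \<phi> x)"
    using continuous_attains_inf by blast
  show ?thesis
  proof (rule that[of "norm (grad \<phi> z)"])
    show "0 < norm (grad \<phi> z)" using nz sub z by auto
    show "norm (grad \<phi> z) \<le> norm (grad \<phi> x)" if "x \<in> \<Omega>" for x
      using z(2) that closure_subset by blast
  qed
qed

section \<open>The asymptotic mean value property\<close>

text \<open>The constants are those of \<open>p_average_4_expansion\<close> for 24 directions with coordinates of
  modulus at most 1: four first derivatives give \<open>4 * M\<close>, half of 16 second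
  derivatives gives \<open>8 * M\<close>, and \<open>4^3\<close> third derivatives give \<open>64 * M\<close>. A vertex has norm at most 4 (the
  sum of its coordinate bounds), so \<open>\<epsilon> < 1/4\<close> keeps the segments inside the extended domain.\<close>

lemma cell24_average_expansion:
  fixes \<phi> :: "real^4 \<Rightarrow> real"
  assumes \<phi>: "\<phi> \<in> Cb_infinity (extended_domain \<Omega>)" and x: "x \<in> \<Omega>"
    and M: "\<And>is y. length is \<le> 3 \<Longrightarrow> y \<in> extended_domain \<Omega> \<Longrightarrow> \<bar>iter_partial_deriv is \<phi> y\<bar> \<le> M"
    and nz: "grad \<phi> x \<noteq> 0"
    and \<epsilon>: "0 < \<epsilon>" "\<epsilon> < 1/4" and \<delta>: "0 < \<delta>" "\<delta> \<le> 1"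
    and small: "24 * (3 * (4 * M)\<^sup>2 * (64 * M) + 3 * (4 * M) * (2 * (8 * M) + 1 + 64 * M)\<^sup>2
                  + (2 * (8 * M) + 1 + 64 * M) ^ 3) * \<epsilon> < 36 * \<delta> * (norm (grad \<phi> x))\<^sup>2"
  shows "\<bar>p_average 4 cell24_vertices \<epsilon> \<phi> x - (\<phi> x + \<epsilon>\<^sup>2 * (2 / 3 * game_laplacian 4 \<phi> x))\<bar> \<le> \<delta> * \<epsilon>\<^sup>2"
proof -
  have smooth: "iter_partial_deriv is \<phi> differentiable (at y)" if "y \<in> extended_domain \<Omega>" for "is" y
    using \<phi> that unfolding Cb_infinity_def by blast
  have near: "x + t *\<^sub>R \<eta> \<in> extended_domain \<Omega>"
    if \<eta>: "\<eta> \<in> cell24_vertices" and t: "0 \<le> t" "t \<le> \<epsilon>" for t \<eta>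
  proof -
    have "norm \<eta> \<le> (\<Sum>i\<in>UNIV. \<bar>\<eta> $ i\<bar>)" by (rule norm_le_l1_cart)
    also have "\<dots> \<le> (\<Sum>i\<in>(UNIV::4 set). 1)"
      by (intro sum_mono cell24_vertices_coord_le_1 \<eta>)
    finally have "norm \<eta> \<le> 4" by simp
    then have "t * norm \<eta> \<le> \<epsilon> * 4" using t by (intro mult_mono) auto
    then have "dist (x + t *\<^sub>R \<eta>) x < 1" using t \<epsilon> by (simp add: dist_norm)
    then show ?thesis
      using infdist_le[OF x, of "x + t *\<^sub>R \<eta>"] by (simp add: extended_domain_def)
  qed
  have xE: "x \<in> extended_domain \<Omega>"
    using x by (simp add: extended_domain_def)
  have card: "card cell24_vertices = 24" and ne: "cell24_vertices \<noteq> {}"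
    by (simp_all add: cell24_vertices_eq vector_4_eq_iff)
  have d: "partial_deriv i \<phi> differentiable (at x)" for i
    using smooth[OF xE, of "[i]"] by simp
  show ?thesis
  proof (rule p_average_4_expansion[OF finite_cell24_vertices ne sum_cell24_odd_moment
      cell24_balance[OF d nz], where A = "4 * M" and Q = "8 * M" and R = "64 * M"])
    fix \<eta> :: "real^4" assume \<eta>: "\<eta> \<in> cell24_vertices"
    note c1 = cell24_vertices_coord_le_1[OF \<eta>]
    have "\<bar>grad \<phi> x \<bullet> \<eta>\<bar> \<le> (\<Sum>i\<in>(UNIV::4 set). M)"
      unfolding inner_vec_def
    proof (intro order_trans[OF sum_abs] sum_mono)
      fix i :: 4
      have "\<bar>grad \<phi> x $ i\<bar> * \<bar>\<eta> $ i\<bar> \<le> M * 1"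
        using M[of "[i]" x] xE c1[of i] by (intro mult_mono) (auto simp: grad_def)
      then show "\<bar>grad \<phi> x $ i \<bullet> \<eta> $ i\<bar> \<le> M" by (simp add: abs_mult)
    qed
    then show "\<bar>grad \<phi> x \<bullet> \<eta>\<bar> \<le> 4 * M" by simp
    have "\<bar>\<Sum>i\<in>UNIV. \<Sum>j\<in>UNIV. \<eta> $ i * \<eta> $ j * iter_partial_deriv [i, j] \<phi> x\<bar>
        \<le> (\<Sum>i\<in>(UNIV::4 set). \<Sum>j\<in>(UNIV::4 set). M)"
    proof (intro order_trans[OF sum_abs] sum_mono)
      fix i j :: 4
      have "\<bar>\<eta> $ i\<bar> * \<bar>\<eta> $ j\<bar> * \<bar>iter_partial_deriv [i, j] \<phi> x\<bar> \<le> 1 * 1 * M"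
        using M[of "[i, j]" x] xE c1 by (intro mult_mono) auto
      then show "\<bar>\<eta> $ i * \<eta> $ j * iter_partial_deriv [i, j] \<phi> x\<bar> \<le> M" by (simp add: abs_mult)
    qed
    then show "\<bar>(\<Sum>i\<in>UNIV. \<Sum>j\<in>UNIV. \<eta> $ i * \<eta> $ j * iter_partial_deriv [i, j] \<phi> x) / 2\<bar> \<le> 8 * M"
      by simp
    show "\<bar>\<phi> (x + \<epsilon> *\<^sub>R \<eta>) - (\<phi> x + \<epsilon> * (grad \<phi> x \<bullet> \<eta>)
        + \<epsilon>\<^sup>2 * ((\<Sum>i\<in>UNIV. \<Sum>j\<in>UNIV. \<eta> $ i * \<eta> $ j * iter_partial_deriv [i, j] \<phi> x) / 2))\<bar>
        \<le> 64 * M * \<epsilon> ^ 3"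
    proof -
      have "real (CARD(4) ^ 3) = 64" by simp
      with taylor_2_bound[OF \<epsilon>(1) smooth[OF near[OF \<eta>]] M[OF _ near[OF \<eta>]] c1]
      show ?thesis by (simp only: list.size)
    qed
  qed (use \<epsilon> \<delta> small in \<open>simp_all add: card sum_cell24_second_moment\<close>)
qed

theorem theorem3p7:
  shows "\<exists>c::real. \<forall>(\<Omega>::(real^4) set) \<phi>.
           open \<Omega> \<and> connected \<Omega> \<and> \<Omega> \<noteq> {} \<and> bounded \<Omega> \<and>
           \<phi> \<in> Cb_infinity (extended_domain \<Omega>) \<and>
           (\<forall>x \<in> extended_domain \<Omega>. grad \<phi> x \<noteq> 0) \<longrightarrow>
           uniform_limit \<Omega>
             (\<lambda>\<epsilon> x. (\<phi> x - (p_average 4 cell24_vertices \<epsilon> \<phi> x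
                               + c * \<epsilon>\<^sup>2 * (- game_laplacian 4 \<phi> x))) / \<epsilon>\<^sup>2)
             (\<lambda>_. 0) (at_right 0)"
proof (intro exI[of _ "2/3"] allI impI, elim conjE)
  fix \<Omega> :: "(real^4) set" and \<phi>
  assume ne: "\<Omega> \<noteq> {}" and bd: "bounded \<Omega>" and \<phi>: "\<phi> \<in> Cb_infinity (extended_domain \<Omega>)"
    and nz: "\<forall>x \<in> extended_domain \<Omega>. grad \<phi> x \<noteq> 0"
  obtain M where M0: "0 \<le> M"
    and M: "\<And>is y. length is \<le> 3 \<Longrightarrow> y \<in> extended_domain \<Omega> \<Longrightarrow> \<bar>iter_partial_deriv is \<phi> y\<bar> \<le> M"
    using Cb_infinity_uniform_bound[OF \<phi>] by blast
  obtain \<gamma> where \<gamma>: "0 < \<gamma>" "\<And>x. x \<in> \<Omega> \<Longrightarrow> \<gamma> \<le> norm (grad \<phi> x)"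
    using grad_bounded_below[OF bd ne \<phi>] nz by blast
  define K where "K = 24 * (3 * (4 * M)\<^sup>2 * (64 * M) + 3 * (4 * M) * (2 * (8 * M) + 1 + 64 * M)\<^sup>2
                  + (2 * (8 * M) + 1 + 64 * M) ^ 3)"
  have K0: "0 < K"
    unfolding K_def using M0 by (intro mult_pos_pos add_nonneg_pos) auto
  show "uniform_limit \<Omega>
         (\<lambda>\<epsilon> x. (\<phi> x - (p_average 4 cell24_vertices \<epsilon> \<phi> x
                           + 2/3 * \<epsilon>\<^sup>2 * (- game_laplacian 4 \<phi> x))) / \<epsilon>\<^sup>2)
         (\<lambda>_. 0) (at_right 0)"
    unfolding uniform_limit_iff
  proof (intro allI impI)
    fix e :: real assume e: "0 < e"
    define \<delta> where "\<delta> = min (e / 2) 1"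
    have \<delta>: "0 < \<delta>" "\<delta> \<le> 1" "\<delta> < e" using e by (auto simp: \<delta>_def)
    \<comment> \<open>The second bound makes \<open>K * \<epsilon>\<close> smaller than the leading coefficient
      \<open>3 * \<delta> * (12 * |g|^2)\<close> throughout \<open>\<Omega>\<close>.\<close>
    define \<epsilon>0 where "\<epsilon>0 = min (1/4) (36 * \<delta> * \<gamma>\<^sup>2 / K)"
    have "0 < \<epsilon>0" using \<delta> \<gamma> K0 by (simp add: \<epsilon>0_def)
    then have "\<forall>\<^sub>F \<epsilon> in at_right 0. \<epsilon> \<in> {0<..<\<epsilon>0}"
      by (rule eventually_at_right_real)
    then show "\<forall>\<^sub>F \<epsilon> in at_right 0. \<forall>x\<in>\<Omega>.
        dist ((\<phi> x - (p_average 4 cell24_vertices \<epsilon> \<phi> x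
               + 2/3 * \<epsilon>\<^sup>2 * (- game_laplacian 4 \<phi> x))) / \<epsilon>\<^sup>2) 0 < e"
    proof (rule eventually_mono, intro ballI)
      fix \<epsilon> x assume "\<epsilon> \<in> {0<..<\<epsilon>0}" and x: "x \<in> \<Omega>"
      then have \<epsilon>: "0 < \<epsilon>" "\<epsilon> < 1/4" "\<epsilon> < 36 * \<delta> * \<gamma>\<^sup>2 / K" by (auto simp: \<epsilon>0_def)
      have "K * \<epsilon> < 36 * \<delta> * \<gamma>\<^sup>2" using \<epsilon>(3) K0 by (simp add: field_simps)
      also have "\<dots> \<le> 36 * \<delta> * (norm (grad \<phi> x))\<^sup>2"
        using \<gamma>(1) \<gamma>(2)[OF x] \<delta> by (intro mult_left_mono power_mono) auto
      finally have small: "K * \<epsilon> < 36 * \<delta> * (norm (grad \<phi> x))\<^sup>2" .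
      have gx: "grad \<phi> x \<noteq> 0" using \<gamma>(1) \<gamma>(2)[OF x] by auto
      let ?d = "p_average 4 cell24_vertices \<epsilon> \<phi> x - (\<phi> x + \<epsilon>\<^sup>2 * (2 / 3 * game_laplacian 4 \<phi> x))"
      have "\<bar>?d\<bar> \<le> \<delta> * \<epsilon>\<^sup>2"
        using cell24_average_expansion[OF \<phi> x M gx \<epsilon>(1,2) \<delta>(1,2)] small unfolding K_def by blast
      also have "\<dots> < e * \<epsilon>\<^sup>2" using \<delta> \<epsilon> by simp
      finally have "\<bar>?d\<bar> / \<epsilon>\<^sup>2 < e" using \<epsilon> by (simp add: field_simps)
      moreover have "dist (- d / \<epsilon>\<^sup>2) 0 = \<bar>d\<bar> / \<epsilon>\<^sup>2" for d
        by (simp add: dist_norm)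
      moreover have "\<phi> x - (p_average 4 cell24_vertices \<epsilon> \<phi> x
          + 2/3 * \<epsilon>\<^sup>2 * (- game_laplacian 4 \<phi> x)) = - ?d"
        by simp
      ultimately show "dist ((\<phi> x - (p_average 4 cell24_vertices \<epsilon> \<phi> x
               + 2/3 * \<epsilon>\<^sup>2 * (- game_laplacian 4 \<phi> x))) / \<epsilon>\<^sup>2) 0 < e"
        by (simp only:)
    qed
  qed
qed

end
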